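(* There is an absolute constant $K_1>0$ such that the following holds. Let $r=r(n)$ satisfy $r \geq K_1 (\log n/n)^{1/4}$ and let $G \in \mathcal{G}(n,r)$. Then $c(G) \leq 2$ with probability tending to $1$ as $n\to\infty$.
   Context: $\mathcal{G}(n,r)$ denotes the random geometric graph $G(x_1,\dots,x_n;r)$ where $x_1,\dots,x_n$ are chosen independently and uniformly at random from $[0,1]^2$, and $x_i,x_j$ ($i\ne j$) are adjacent iff $\|x_i-x_j\|\le r$ (Euclidean norm). Game of cops and robbers on a finite graph: cops choose starting vertices, then the robber; players alternate turns, each agent moving to an adjacent vertex or staying put (cops move simultaneously; full information); cops win if some cop eventually occupies the robber's vertex. The cop number $c(G)$ is the minimum number of cops having a strategy that wins against every robber strategy. *)

theory Defs
  imports "HOL-Probability.Probability"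
begin

text \<open>A graph is given by a vertex set V and a (symmetric, irreflexive) adjacency
relation E. Closed neighbourhood of v: v itself together with its neighbours.\<close>

definition closed_nbhd :: "'a set \<Rightarrow> ('a \<Rightarrow> 'a \<Rightarrow> bool) \<Rightarrow> 'a \<Rightarrow> 'a set" where
  "closed_nbhd V E v = insert v {u \<in> V. E v u}"

text \<open>A strategy for k cops (indexed 0..k-1) maps the history of robber positions
seen so far to the current cop configuration: the empty history gives the initial
placement; after the robber has occupied R 0, ..., R t, the cops move to the
configuration given by the history [R 0, ..., R t]. (The cops' own past moves are
determined by the strategy, so this is a full-information strategy.) Each cop must
stay in V and each move must go to an adjacent vertex or stay put.\<close>

definition cop_strategy :: "'a set \<Rightarrow> ('a \<Rightarrow> 'a \<Rightarrow> bool) \<Rightarrow> nat \<Rightarrow> ('a list \<Rightarrow> nat \<Rightarrow> 'a) \<Rightarrow> bool" where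
  "cop_strategy V E k \<sigma> \<longleftrightarrow>
     (\<forall>hs i. i < k \<longrightarrow> \<sigma> hs i \<in> V) \<and>
     (\<forall>hs r i. i < k \<longrightarrow> \<sigma> (hs @ [r]) i \<in> closed_nbhd V E (\<sigma> hs i))"

text \<open>A robber play: start anywhere in V (chosen after seeing the initial cop
placement), then each move to an adjacent vertex or stay put. Since the robber has
full information, quantifying over all such sequences is the same as quantifying over
all robber strategies against a fixed cop strategy.\<close>

definition robber_walk :: "'a set \<Rightarrow> ('a \<Rightarrow> 'a \<Rightarrow> bool) \<Rightarrow> (nat \<Rightarrow> 'a) \<Rightarrow> bool" where
  "robber_walk V E R \<longleftrightarrow> R 0 \<in> V \<and> (\<forall>t. R (Suc t) \<in> closed_nbhd V E (R t))"

text \<open>Cop positions at time t (cops' configuration after their t-th move,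
time 0 = initial placement).\<close>

definition cop_pos :: "('a list \<Rightarrow> nat \<Rightarrow> 'a) \<Rightarrow> (nat \<Rightarrow> 'a) \<Rightarrow> nat \<Rightarrow> nat \<Rightarrow> 'a" where
  "cop_pos \<sigma> R t = \<sigma> (map R [0..<t])"

text \<open>Capture: either the robber stands on a cop after the robber's t-th move, or
a cop moves onto the robber in the cops' (t+1)-st move.\<close>

definition captured :: "nat \<Rightarrow> ('a list \<Rightarrow> nat \<Rightarrow> 'a) \<Rightarrow> (nat \<Rightarrow> 'a) \<Rightarrow> bool" where
  "captured k \<sigma> R \<longleftrightarrow>
     (\<exists>t. \<exists>i<k. cop_pos \<sigma> R t i = R t \<or> cop_pos \<sigma> R (Suc t) i = R t)"

definition cops_win :: "'a set \<Rightarrow> ('a \<Rightarrow> 'a \<Rightarrow> bool) \<Rightarrow> nat \<Rightarrow> bool" where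
  "cops_win V E k \<longleftrightarrow>
     (\<exists>\<sigma>. cop_strategy V E k \<sigma> \<and> (\<forall>R. robber_walk V E R \<longrightarrow> captured k \<sigma> R))"

definition cop_number :: "'a set \<Rightarrow> ('a \<Rightarrow> 'a \<Rightarrow> bool) \<Rightarrow> nat" where
  "cop_number V E = (LEAST k. cops_win V E k)"

text \<open>Points are in real \<times> real; dist on the product type is the Euclidean distance.
Vertices are 0..n-1.\<close>

definition geom_adj :: "(nat \<Rightarrow> real \<times> real) \<Rightarrow> real \<Rightarrow> nat \<Rightarrow> nat \<Rightarrow> bool" where
  "geom_adj x r i j \<longleftrightarrow> i \<noteq> j \<and> dist (x i) (x j) \<le> r"

definition unit_square :: "(real \<times> real) set" where
  "unit_square = {0..1} \<times> {0..1}"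

definition rgg_space :: "nat \<Rightarrow> (nat \<Rightarrow> real \<times> real) measure" where
  "rgg_space n = PiM {..<n} (\<lambda>_. uniform_measure lborel unit_square)"

end

theory Submission
  imports Defs "HOL-Real_Asymp.Real_Asymp"
begin

text \<open>
  With high probability every point of the unit square has a vertex within distance
  \<open>\<delta> = r\<^sup>2 / 100000\<close>, so the cops can imitate two ideal pursuers that move freely in the square
  with the slightly reduced speed \<open>r - 2 \<delta>\<close>.

  The pursuers share the abscissa \<open>f(x)\<close>, where \<open>x\<close> is the abscissa of the robber and \<open>f\<close> is
  Lipschitz with constant \<open>1 - r / 1000\<close> and fixes the right-hand wall. The contraction pays for the
  loss of speed: whenever the robber moves mostly horizontally, both pursuers follow and still have
  vertical speed to spare. When the robber moves mostly vertically, the pursuer ahead of it gains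
  far more than the other one loses. Hence the robber ends up squeezed between the pursuers, one
  about \<open>r / 100\<close> above it and one as far below. From then on the only moves that avoid capture go
  left by at least \<open>r / 2\<close>: the pursuers are slightly to the right of the robber, because
  \<open>f(x) \<ge> x\<close>, and at the right-hand wall there is no room to move right. So the robber is caught
  at the left-hand wall at the latest.

  Density holds because a grid of about \<open>n / (2 ln n)\<close> cells has an empty cell with probability at
  most \<open>1 / n\<close>.
\<close>

section \<open>Winning by a potential\<close>

text \<open>\<open>W c L \<phi>\<close> describes positions with the cops at \<open>c\<close> and the robber about to choose a vertex of
  \<open>L\<close>; taking \<open>L\<close> to be all of \<open>V\<close> covers the robber's initial placement.\<close>

lemma cops_win_by_potential:
  fixes W :: "(nat \<Rightarrow> 'a) \<Rightarrow> 'a set \<Rightarrow> real \<Rightarrow> bool"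
  assumes d: "d > 0"
    and init: "W start V bnd"
    and nonneg: "\<And>c L \<phi>. W c L \<phi> \<Longrightarrow> \<phi> \<ge> 0"
    and inV: "\<And>i. i < k \<Longrightarrow> start i \<in> V"
    and step: "\<And>c L \<phi> v. W c L \<phi> \<Longrightarrow> v \<in> L \<Longrightarrow> (\<forall>i<k. v \<notin> closed_nbhd V E (c i)) \<Longrightarrow>
       \<exists>c' \<phi>'. W c' (closed_nbhd V E v) \<phi>' \<and> \<phi>' \<le> \<phi> - d \<and> (\<forall>i<k. c' i \<in> closed_nbhd V E (c i))"
  shows "cops_win V E k"
proof -
  let ?N = "closed_nbhd V E"
  define good where "good c L \<phi> v c' \<phi>' \<longleftrightarrow>
     W c' (?N v) \<phi>' \<and> \<phi>' \<le> \<phi> - d \<and> (\<forall>i<k. c' i \<in> ?N (c i))" for c and L :: "'a set" and \<phi> v c' \<phi>'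
  \<comment> \<open>The state is folded over the robber's history. A cop that can reach
    \<open>v\<close> takes it; otherwise a move supplied by \<open>step\<close> is chosen. In the
    remaining case the cops stay put, which keeps the strategy legal on histories that are no
    walks.\<close>
  define nxt where "nxt = (\<lambda>(c, L, \<phi>) v.
     if \<exists>i<k. v \<in> ?N (c i) then ((\<lambda>i. if v \<in> ?N (c i) then v else c i), L, \<phi>)
     else if \<exists>c' \<phi>'. good c L \<phi> v c' \<phi>'
       then (let p = (SOME p. good c L \<phi> v (fst p) (snd p)) in (fst p, ?N v, snd p))
     else (c, L, \<phi>))"
  define st where "st hs = foldl nxt (start, V, bnd) hs" for hs
  define \<sigma> where "\<sigma> hs = fst (st hs)" for hs
  have st_snoc: "st (hs @ [v]) = nxt (st hs) v" for hs v
    by (simp add: st_def)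
  have self: "c \<in> ?N c" for c by (simp add: closed_nbhd_def)
  have legal: "fst (nxt s v) i \<in> ?N (fst s i)" if "i < k" for s v i
  proof -
    obtain c L \<phi> where s: "s = (c, L, \<phi>)" by (cases s) auto
    consider "\<exists>i<k. v \<in> ?N (c i)" | "\<not> (\<exists>i<k. v \<in> ?N (c i))" "\<exists>p. good c L \<phi> v (fst p) (snd p)"
      | "\<not> (\<exists>i<k. v \<in> ?N (c i))" "\<not> (\<exists>c' \<phi>'. good c L \<phi> v c' \<phi>')" by auto
    then show ?thesis
    proof cases
      case 2
      have "good c L \<phi> v (fst (SOME p. good c L \<phi> v (fst p) (snd p))) (snd (SOME p. good c L \<phi> v (fst p) (snd p)))"
        using 2(2) by (rule someI_ex)
      then have "fst (SOME p. good c L \<phi> v (fst p) (snd p)) i \<in> ?N (c i)"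
        using that unfolding good_def by blast
      then show ?thesis using 2 by (auto simp: nxt_def s Let_def)
    qed (auto simp: nxt_def s self)
  qed
  have N_V: "?N c \<subseteq> V" if "c \<in> V" for c
    using that by (auto simp: closed_nbhd_def)
  have strat: "cop_strategy V E k \<sigma>"
    unfolding cop_strategy_def
  proof (intro conjI allI impI)
    fix hs i assume i: "i < k"
    show "\<sigma> hs i \<in> V"
    proof (induction hs rule: rev_induct)
      case Nil then show ?case using inV i by (simp add: \<sigma>_def st_def)
    next
      case (snoc v hs)
      then show ?case using legal[OF i, of "st hs" v] N_V by (auto simp: \<sigma>_def st_snoc)
    qed
  next
    fix hs r i assume "i < k"
    then show "\<sigma> (hs @ [r]) i \<in> ?N (\<sigma> hs i)" using legal by (auto simp: \<sigma>_def st_snoc)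
  qed
  moreover have "captured k \<sigma> R" if R: "robber_walk V E R" for R
  proof (rule ccontr)
    assume nc: "\<not> captured k \<sigma> R"
    define s where "s t = st (map R [0..<t])" for t
    have s_Suc: "s (Suc t) = nxt (s t) (R t)" for t
      by (simp add: s_def st_snoc)
    \<comment> \<open>A robber within reach would have been taken by \<open>nxt\<close>, so the last
      premise of \<open>step\<close> is available in every round.\<close>
    have free: "R t \<notin> ?N (fst (s t) i)" if "i < k" for t i
    proof
      assume a: "R t \<in> ?N (fst (s t) i)"
      then have "fst (s (Suc t)) i = R t"
        using that by (cases "s t") (auto simp: s_Suc nxt_def)
      then have "cop_pos \<sigma> R (Suc t) i = R t" by (simp add: cop_pos_def \<sigma>_def s_def)
      then show False using nc that unfolding captured_def by blast
    qed
    have inv: "\<exists>c L \<phi>. s t = (c, L, \<phi>) \<and> W c L \<phi> \<and> R t \<in> L \<and> \<phi> \<le> bnd - real t * d" for t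
    proof (induction t)
      case 0
      then show ?case using init R by (auto simp: s_def st_def robber_walk_def)
    next
      case (Suc t)
      then obtain c L \<phi> where *: "s t = (c, L, \<phi>)" "W c L \<phi>" "R t \<in> L" "\<phi> \<le> bnd - real t * d" by blast
      have fr: "\<forall>i<k. R t \<notin> ?N (c i)" using free[of _ t] * by auto
      have ex: "\<exists>c' \<phi>'. good c L \<phi> (R t) c' \<phi>'"
        using step[OF *(2,3) fr] unfolding good_def by blast
      define p where "p = (SOME p. good c L \<phi> (R t) (fst p) (snd p))"
      have "good c L \<phi> (R t) (fst p) (snd p)" unfolding p_def
        using ex by (intro someI_ex[of "\<lambda>p. good c L \<phi> (R t) (fst p) (snd p)"]) auto
      moreover have "s (Suc t) = (fst p, ?N (R t), snd p)"
        using fr ex by (auto simp: s_Suc * nxt_def p_def Let_def)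
      moreover have "R (Suc t) \<in> ?N (R t)" using R by (simp add: robber_walk_def)
      ultimately show ?case using *(4) by (auto simp: good_def algebra_simps)
    qed
    obtain t :: nat where "bnd < real t * d"
      using reals_Archimedean3[OF d] by blast
    moreover obtain c L \<phi> where "W c L \<phi>" "\<phi> \<le> bnd - real t * d" using inv[of t] by blast
    ultimately show False using nonneg[of c L \<phi>] by linarith
  qed
  ultimately show ?thesis unfolding cops_win_def by blast
qed

section \<open>Pursuit in the unit square\<close>

text \<open>The steep summand creates a lag of order \<open>r / 1000\<close> within one step of the right-hand wall,
  which is what stops a squeezed robber from oscillating there; the last summand keeps the Lipschitz
  constant at most \<open>1 - r / 1000\<close> everywhere.\<close>

definition shadow :: "real \<Rightarrow> real \<Rightarrow> real" where
  "shadow r x = x + min (1 - x) r / 1000 + r * (1 - x) / 1000"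

text \<open>Ordinate at which the lower pursuer lies in wait for a robber at height \<open>y\<close>. The upper pursuer
  is described throughout by its distance from the top, i.e. in the reflected coordinate
  \<open>1 - y\<close>.\<close>

definition below :: "real \<Rightarrow> real \<Rightarrow> real" where
  "below r y = max 0 (y - r / 100)"

text \<open>The slope of \<open>shadow\<close> is \<open>1 - r / 1000\<close>, lowered by a further
  \<open>1 / 1000\<close> where the minimum equals \<open>1 - x\<close>. It stays nonnegative, so
  its largest value is the Lipschitz constant.\<close>

lemma shadow_diff:
  assumes "0 < r" "r \<le> 3/2"
  shows "\<bar>shadow r x' - shadow r x\<bar> \<le> (1 - r / 1000) * \<bar>x' - x\<bar>"
proof -
  have *: "\<bar>shadow r v - shadow r u\<bar> \<le> (1 - r / 1000) * (v - u)" if "u \<le> v" for u v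
  proof -
    define m where "m = min (1 - u) r - min (1 - v) r"
    have m: "0 \<le> m" "m \<le> v - u" using that by (auto simp: m_def)
    have e: "shadow r v - shadow r u = (1 - r / 1000) * (v - u) - m / 1000"
      by (simp add: shadow_def m_def field_simps)
    have "m / 1000 \<le> (1 - r / 1000) * (v - u)"
    proof -
      have "m / 1000 \<le> (1/1000) * (v - u)" using m by simp
      also have "\<dots> \<le> (1 - r / 1000) * (v - u)"
        using that assms by (intro mult_right_mono) auto
      finally show ?thesis .
    qed
    then show ?thesis using e m by linarith
  qed
  show ?thesis
  proof (cases "x \<le> x'")
    case True then show ?thesis using *[of x x'] by simp
  next
    case False then show ?thesis using *[of x' x] by (simp add: abs_minus_commute)
  qed
qed

lemma shadow_bounds:
  assumes "0 < r" "r \<le> 3/2" "0 \<le> x" "x \<le> 1"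
  shows "x \<le> shadow r x" "shadow r x \<le> x + r / 500" "shadow r x \<le> 1"
    "min (1 - x) r / 1000 \<le> shadow r x - x"
proof -
  define z m where "z = r * (1 - x)" and "m = min (1 - x) r"
  have "0 \<le> z" "z \<le> r * 1" unfolding z_def
    using assms by (auto intro!: mult_nonneg_nonneg mult_left_mono)
  moreover have "z \<le> (3/2) * (1 - x)"
    unfolding z_def using assms by (intro mult_right_mono) auto
  then have "2 * z + 3 * x \<le> 3" by (simp add: field_simps)
  moreover have "shadow r x = x + m / 1000 + z / 1000"
    by (simp add: shadow_def z_def m_def)
  moreover have "0 \<le> m" "m \<le> 1 - x" "m \<le> r"
    using assms by (auto simp: m_def)
  ultimately have "x \<le> shadow r x \<and> shadow r x \<le> x + r / 500 \<and>
    shadow r x \<le> 1 \<and> m / 1000 \<le> shadow r x - x"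
    using assms by (intro conjI) linarith+
  then show "x \<le> shadow r x" "shadow r x \<le> x + r / 500"
    "shadow r x \<le> 1" "min (1 - x) r / 1000 \<le> shadow r x - x" by (auto simp: m_def)
qed

section \<open>Vertical speed left after following the shadow\<close>

lemma speed_sq_ge:
  fixes r :: real
  assumes "0 < r" "r \<le> 3/2"
  shows "r\<^sup>2 - r^3 / 25000 \<le> (r - r\<^sup>2 / 50000)\<^sup>2" "r^3 \<le> 3/2 * r\<^sup>2" "r^4 \<le> 3/2 * r^3" "r\<^sup>2 \<le> 3/2 * r"
proof -
  have "(r - r\<^sup>2 / 50000)\<^sup>2 = r\<^sup>2 - r^3 / 25000 + (r\<^sup>2 / 50000)\<^sup>2"
    by (simp add: power2_eq_square power3_eq_cube algebra_simps)
  then show "r\<^sup>2 - r^3 / 25000 \<le> (r - r\<^sup>2 / 50000)\<^sup>2" by simp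
  have "r * r^k \<le> 3/2 * r^k" for k using assms by (intro mult_right_mono) auto
  from this[of 1] this[of 2] this[of 3]
  show "r^3 \<le> 3/2 * r\<^sup>2" "r^4 \<le> 3/2 * r^3" "r\<^sup>2 \<le> 3/2 * r"
    by (auto simp: eval_nat_numeral)
qed

text \<open>Here \<open>(a, b)\<close> is the robber's move, \<open>D\<close> the horizontal move of
  the pursuers and \<open>V\<close> their remaining vertical speed. If \<open>\<bar>a\<bar>\<close>
  is at least \<open>r / 2\<close>, the contraction makes \<open>a^2 - D^2\<close> at least
  \<open>r^3 / 4000\<close>, well above the \<open>r^3 / 25000\<close> lost in the squared speed. If
  both components are at most \<open>r / 2\<close>, then \<open>V\<close> is at least
  \<open>4 / 5 * r\<close>.\<close>

lemma vertical_budget_fast: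
  fixes a b D V r :: real
  assumes r: "0 < r" "r \<le> 3/2"
    and ab: "a\<^sup>2 + b\<^sup>2 \<le> r\<^sup>2" and D: "\<bar>D\<bar> \<le> (1 - r / 1000) * \<bar>a\<bar>"
    and V: "V \<ge> 0" "V\<^sup>2 = (r - r\<^sup>2 / 50000)\<^sup>2 - D\<^sup>2"
    and h: "\<bar>a\<bar> \<ge> r / 2 \<or> \<bar>b\<bar> \<le> r / 2"
  shows "\<bar>b\<bar> + r\<^sup>2 / 20000 \<le> V"
proof -
  note sq = speed_sq_ge[OF r]
  define t where "t = 1 - r / 1000"
  have t: "0 \<le> t" "t \<le> 1" using r by (auto simp: t_def)
  have "D\<^sup>2 \<le> (t * \<bar>a\<bar>)\<^sup>2" using D by (simp add: t_def abs_le_square_iff[symmetric])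
  also have "\<dots> = t * (t * a\<^sup>2)" by (simp add: power_mult_distrib power2_eq_square)
  also have "\<dots> \<le> 1 * (t * a\<^sup>2)" using t by (intro mult_right_mono) auto
  finally have D2: "D\<^sup>2 \<le> a\<^sup>2 - r * a\<^sup>2 / 1000" by (simp add: t_def algebra_simps)
  show ?thesis
  proof (cases "\<bar>a\<bar> \<ge> r / 2")
    case True
    have "(r/2)\<^sup>2 \<le> \<bar>a\<bar>\<^sup>2" using True r by (intro power_mono) auto
    then have "r * (r\<^sup>2 / 4) \<le> r * a\<^sup>2" using r by (intro mult_left_mono) (auto simp: power_divide)
    then have "r^3 / 4 \<le> r * a\<^sup>2" by (simp add: power2_eq_square power3_eq_cube)
    then have V2: "b\<^sup>2 + 21 / 100000 * r^3 \<le> V\<^sup>2"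
      using V(2) D2 ab sq(1) by linarith
    have "\<bar>b\<bar> \<le> r" using ab r by (metis abs_le_square_iff abs_of_pos add_increasing zero_le_power2 order_trans le_add_same_cancel2)
    then have "\<bar>b\<bar> * r\<^sup>2 \<le> r * r\<^sup>2" by (intro mult_right_mono) auto
    then have "\<bar>b\<bar> * r\<^sup>2 \<le> r^3" by (simp add: power2_eq_square power3_eq_cube)
    moreover have "(\<bar>b\<bar> + r\<^sup>2 / 20000)\<^sup>2 = b\<^sup>2 + \<bar>b\<bar> * r\<^sup>2 / 10000 + r^4 / 400000000"
      by (simp add: power2_sum power_divide eval_nat_numeral algebra_simps)
    moreover have "0 \<le> r^3" using r by simp
    ultimately have "(\<bar>b\<bar> + r\<^sup>2 / 20000)\<^sup>2 \<le> V\<^sup>2" using V2 sq(3) by linarith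
    then show ?thesis using V(1) by (rule power2_le_imp_le)
  next
    case False
    then have b: "\<bar>b\<bar> \<le> r / 2" using h by simp
    have "\<bar>a\<bar>\<^sup>2 \<le> (r/2)\<^sup>2" using False r by (intro power_mono) auto
    then have "a\<^sup>2 \<le> r\<^sup>2 / 4" by (simp add: power_divide)
    moreover have "0 \<le> r * a\<^sup>2" using r by simp
    moreover have "(4 / 5 * r)\<^sup>2 = 16 / 25 * r\<^sup>2" by (simp add: power_mult_distrib power_divide)
    moreover have "0 \<le> r\<^sup>2" by simp
    ultimately have "(4 / 5 * r)\<^sup>2 \<le> V\<^sup>2" using V(2) D2 sq(1,2) by linarith
    then have "4 / 5 * r \<le> V" using V(1) by (rule power2_le_imp_le)
    then show ?thesis using b sq(4) r by linarith
  qed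
qed

text \<open>For a steep move only \<open>D^2 \<le> a^2\<close> is used. The loss
  \<open>r^3 / 25000\<close> in the square, divided by \<open>2 * \<bar>b\<bar> > r\<close>, costs
  about \<open>r^2 / 25000\<close> of speed; the doubled constant absorbs the quadratic
  term.\<close>

lemma vertical_budget_slow:
  fixes a b D V r :: real
  assumes r: "0 < r" "r \<le> 3/2"
    and ab: "a\<^sup>2 + b\<^sup>2 \<le> r\<^sup>2" and D: "\<bar>D\<bar> \<le> (1 - r / 1000) * \<bar>a\<bar>"
    and V: "V \<ge> 0" "V\<^sup>2 = (r - r\<^sup>2 / 50000)\<^sup>2 - D\<^sup>2"
    and b: "\<bar>b\<bar> > r / 2"
  shows "\<bar>b\<bar> - r\<^sup>2 / 12500 \<le> V"
proof -
  note sq = speed_sq_ge[OF r]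
  have "\<bar>D\<bar> \<le> 1 * \<bar>a\<bar>" using D r mult_right_mono[of "1 - r / 1000" 1 "\<bar>a\<bar>"] by auto
  then have "D\<^sup>2 \<le> a\<^sup>2" by (simp add: abs_le_square_iff[symmetric])
  then have V2: "b\<^sup>2 - r^3 / 25000 \<le> V\<^sup>2" using V(2) ab sq(1) by linarith
  have "(r / 2) * r\<^sup>2 \<le> \<bar>b\<bar> * r\<^sup>2" using b by (intro mult_right_mono) auto
  then have "r^3 / 2 \<le> \<bar>b\<bar> * r\<^sup>2" by (simp add: power2_eq_square power3_eq_cube)
  moreover have "(\<bar>b\<bar> - r\<^sup>2 / 12500)\<^sup>2 = b\<^sup>2 - \<bar>b\<bar> * r\<^sup>2 / 6250 + r^4 / 156250000"
    by (simp add: power2_diff power_divide eval_nat_numeral algebra_simps)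
  moreover have "0 \<le> r^3" using r by simp
  ultimately have "(\<bar>b\<bar> - r\<^sup>2 / 12500)\<^sup>2 \<le> V\<^sup>2" using V2 sq(3) by linarith
  then show ?thesis using V(1) by (rule power2_le_imp_le)
qed

section \<open>What an escape forces on the robber's move\<close>

text \<open>Expanding the squares and subtracting \<open>ab\<close> linearises the escape: the
  robber's move has a small inner product with its offset \<open>(e, -H)\<close> to the lower
  pursuer. The slack \<open>3 / 50000 * r^2\<close> bounds \<open>r^3 / 25000\<close>.\<close>

lemma escape_quadratic:
  fixes e a H \<beta> r :: real
  assumes r: "0 < r" "r \<le> 3/2"
    and esc: "(r - r\<^sup>2 / 50000)\<^sup>2 < (e - a)\<^sup>2 + (H - \<beta>)\<^sup>2" and ab: "a\<^sup>2 + \<beta>\<^sup>2 \<le> r\<^sup>2"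
  shows "2 * (H * \<beta>) + 2 * (e * a) < e\<^sup>2 + H\<^sup>2 + 3 / 50000 * r\<^sup>2"
  using esc ab speed_sq_ge(1,2)[OF r] by (simp add: power2_diff algebra_simps)

text \<open>A steep descent runs towards the lower pursuer: \<open>H\<close> is at least
  \<open>r / 100\<close>, so a drop beyond \<open>r / 4\<close> would make
  \<open>H * \<beta>\<close> too large; close to the bottom wall there is no room for it. Hence a
  steep escape is possible only if that pursuer is still \<open>r / 100\<close> short of its waiting
  place.\<close>

lemma approach_slow:
  assumes r: "0 < r" "r \<le> 3/2"
    and esc: "(r - r\<^sup>2 / 50000)\<^sup>2 < (e - a)\<^sup>2 + (y - \<beta> - u)\<^sup>2" and ab: "a\<^sup>2 + \<beta>\<^sup>2 \<le> r\<^sup>2"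
    and e: "0 \<le> e" "e \<le> r / 500" and a: "\<bar>a\<bar> \<le> r / 2" and \<beta>: "0 \<le> \<beta>" "\<beta> \<le> y"
    and u: "u \<le> below r y" "below r y - u < r / 100"
  shows "\<beta> \<le> r / 4"
proof (cases "y \<le> r / 100")
  case True
  then show ?thesis using \<beta> r by simp
next
  case False
  define H where "H = y - u"
  have H: "r / 100 \<le> H" "H \<le> r / 50" using u False by (auto simp: below_def H_def)
  have "2 * (H * \<beta>) + 2 * (e * a) < e\<^sup>2 + H\<^sup>2 + 3 / 50000 * r\<^sup>2"
    using escape_quadratic[OF r _ ab, of e H] esc by (simp add: H_def algebra_simps)
  moreover have "- (e * a) \<le> r / 500 * (r / 2)"
  proof -
    have "- (e * a) \<le> \<bar>e\<bar> * \<bar>a\<bar>" by (metis abs_ge_minus_self abs_mult)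
    also have "\<dots> \<le> r / 500 * (r / 2)" using e a r by (intro mult_mono) auto
    finally show ?thesis .
  qed
  moreover have "e\<^sup>2 \<le> (r / 500)\<^sup>2" "H\<^sup>2 \<le> (r / 50)\<^sup>2" using e H r by (auto intro!: power_mono)
  moreover have "0 < r\<^sup>2" using r by simp
  ultimately have *: "2 * (H * \<beta>) < r\<^sup>2 / 200"
    by (simp add: power_divide power2_eq_square)
  show ?thesis
  proof (rule ccontr)
    assume "\<not> ?thesis"
    then have "(r / 100) * (r / 4) \<le> H * \<beta>" using H r by (intro mult_mono) auto
    then show False using * by (simp add: power2_eq_square)
  qed
qed

text \<open>A move with small \<open>\<bar>a\<bar>\<close> is also vertically small and ends within
  reach; a long move to the right heads towards the pursuer, which is ahead in that
  direction.\<close>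

lemma locked_forces_left:
  assumes r: "0 < r" "r \<le> 3/2"
    and esc: "(r - r\<^sup>2 / 50000)\<^sup>2 < (shadow r x - x - a)\<^sup>2 + (y - \<beta> - below r y)\<^sup>2"
    and ab: "a\<^sup>2 + \<beta>\<^sup>2 \<le> r\<^sup>2"
    and x: "0 \<le> x" "x \<le> 1" "x + a \<le> 1" and \<beta>: "0 \<le> \<beta>" "\<beta> \<le> y"
  shows "a \<le> - r / 2"
proof (rule ccontr)
  assume na: "\<not> a \<le> - r / 2"
  define e where "e = shadow r x - x"
  define H where "H = y - below r y"
  have e: "0 \<le> e" "e \<le> r / 500" "min (1 - x) r / 1000 \<le> e"
    using shadow_bounds[OF r x(1,2)] by (auto simp: e_def)
  have H: "0 \<le> H" "H \<le> r / 100" using \<beta> r by (auto simp: below_def H_def max_def)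
  note sq = speed_sq_ge[OF r]
  have r2: "0 < r\<^sup>2" using r by simp
  show False
  proof (cases "a < r / 2")
    case True
    then have a: "\<bar>a\<bar> \<le> r / 2" using na by simp
    have "\<beta> \<le> r / 4"
      by (rule approach_slow[OF r _ ab e(1,2) a \<beta>, of "below r y"]) (use esc r in \<open>auto simp: e_def\<close>)
    then have "\<bar>H - \<beta>\<bar> \<le> r / 4" using H \<beta> r by linarith
    then have "\<bar>H - \<beta>\<bar>\<^sup>2 \<le> (r / 4)\<^sup>2" by (intro power_mono) auto
    moreover have "\<bar>e - a\<bar> \<le> 3 / 5 * r" using e(1,2) a r by linarith
    then have "\<bar>e - a\<bar>\<^sup>2 \<le> (3 / 5 * r)\<^sup>2" by (intro power_mono) auto
    ultimately have "(e - a)\<^sup>2 + (H - \<beta>)\<^sup>2 \<le> 9 / 25 * r\<^sup>2 + r\<^sup>2 / 16"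
      by (simp add: power_mult_distrib power_divide)
    moreover have "(r - r\<^sup>2 / 50000)\<^sup>2 < (e - a)\<^sup>2 + (H - \<beta>)\<^sup>2"
      using esc by (simp add: e_def H_def algebra_simps)
    ultimately show False using sq(1,2) r2 by linarith
  next
    case False
    have "2 * (H * \<beta>) + 2 * (e * a) < e\<^sup>2 + H\<^sup>2 + 3 / 50000 * r\<^sup>2"
      using escape_quadratic[OF r _ ab, of e H] esc by (simp add: e_def H_def algebra_simps)
    moreover have "0 \<le> H * \<beta>" using H \<beta> by simp
    moreover have "H\<^sup>2 \<le> (r / 100)\<^sup>2" "e\<^sup>2 \<le> (r / 500)\<^sup>2" using e H by (auto intro!: power_mono)
    \<comment> \<open>A move right by \<open>r / 2\<close> needs that much room before the wall, so
      the steep summand of \<open>shadow\<close> makes the lag at least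
      \<open>r / 2000\<close>.\<close>
    moreover have "r / 2000 \<le> e" using e(3) False x r by (auto simp: min_def split: if_splits)
    then have "(r / 2000) * (r / 2) \<le> e * a" using False r e by (intro mult_mono) auto
    ultimately show False using r2 by (simp add: power_divide power2_eq_square)
  qed
qed


text \<open>One round with the robber not moving up; upward moves follow by reflection. If the move
  is not steep, each gap closes or shrinks. In a steep move the lower pursuer gains
  \<open>r / 100\<close>, far more than the \<open>r^2 / 12500\<close> the upper one may
  lose.\<close>

lemma squeeze_step:
  fixes x y x' y' u w r V :: real
  assumes r: "0 < r" "r \<le> 3/2"
    and sq: "0 \<le> x" "x \<le> 1" "0 \<le> x'" "x' \<le> 1" "0 \<le> y'" "y' \<le> y"
    and mv: "(x' - x)\<^sup>2 + (y' - y)\<^sup>2 \<le> r\<^sup>2"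
    and u: "u \<le> below r y" and w: "w \<le> below r (1 - y)"
    and esc: "(r - r\<^sup>2 / 50000)\<^sup>2 < (shadow r x - x')\<^sup>2 + (u - y')\<^sup>2"
    and V: "V \<ge> 0" "V\<^sup>2 = (r - r\<^sup>2 / 50000)\<^sup>2 - (shadow r x' - shadow r x)\<^sup>2"
    and u': "u' = min (below r y') (u + V)" and w': "w' = min (below r (1 - y')) (w + V)"
  shows "u - V \<le> below r y'" "w - V \<le> below r (1 - y')"
    "u' = below r y' \<and> w' = below r (1 - y') \<or>
     (below r y' - u') + (below r (1 - y') - w') \<le> (below r y - u) + (below r (1 - y) - w) - r\<^sup>2 / 20000"
    "u = below r y \<Longrightarrow> w = below r (1 - y) \<Longrightarrow>
       x' \<le> x - r / 2 \<and> u' = below r y' \<and> w' = below r (1 - y')"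
proof -
  define \<beta> where "\<beta> = y - y'"
  have \<beta>: "0 \<le> \<beta>" "\<beta> \<le> y" using sq by (auto simp: \<beta>_def)
  note D = shadow_diff[OF r, of x' x]
  note sqs = speed_sq_ge[OF r]
  have r2: "0 < r\<^sup>2" using r by simp
  have ab: "(x' - x)\<^sup>2 + \<beta>\<^sup>2 \<le> r\<^sup>2" using mv by (simp add: \<beta>_def power2_commute)
  have lu: "below r y' \<le> below r y" "below r y - \<beta> \<le> below r y'" using sq by (auto simp: below_def \<beta>_def max_def)
  have lw: "below r (1 - y) \<le> below r (1 - y')" "below r (1 - y') \<le> below r (1 - y) + \<beta>"
    using sq by (auto simp: below_def \<beta>_def)
  have e: "0 \<le> shadow r x - x" "shadow r x - x \<le> r / 500"
    using shadow_bounds[OF r sq(1,2)] by auto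
  have esc': "(r - r\<^sup>2 / 50000)\<^sup>2 < (shadow r x - x - (x' - x))\<^sup>2 + (y - \<beta> - u)\<^sup>2"
    using esc by (simp add: \<beta>_def power2_commute)
  show w1: "w - V \<le> below r (1 - y')" using w lw V by simp
  have fast: "\<beta> + r\<^sup>2 / 20000 \<le> V" if "\<bar>x' - x\<bar> \<ge> r / 2 \<or> \<beta> \<le> r / 2"
    using vertical_budget_fast[OF r ab D V] that \<beta> by simp
  have slow: "\<beta> - r\<^sup>2 / 12500 \<le> V \<and> r / 100 \<le> below r y - u"
    if "\<not> (\<bar>x' - x\<bar> \<ge> r / 2 \<or> \<beta> \<le> r / 2)"
  proof
    show "\<beta> - r\<^sup>2 / 12500 \<le> V" using vertical_budget_slow[OF r ab D V] that \<beta> by simp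
    show "r / 100 \<le> below r y - u"
    proof (rule ccontr)
      assume "\<not> ?thesis"
      then have "\<beta> \<le> r / 4" using that
        by (intro approach_slow[OF r esc' ab e _ \<beta> u]) auto
      then show False using that r by simp
    qed
  qed
  \<comment> \<open>The lower waiting place can sink, so this pursuer may have to retreat; in a
    steep move its gap of \<open>r / 100\<close> makes up for the missing speed.\<close>
  show u1: "u - V \<le> below r y'"
  proof (cases "\<bar>x' - x\<bar> \<ge> r / 2 \<or> \<beta> \<le> r / 2")
    case True then show ?thesis using fast r2 u lu by linarith
  next
    case False
    then show ?thesis using slow[OF False] lu u sqs(4) r by linarith
  qed
  show "u' = below r y' \<and> w' = below r (1 - y') \<or>
     (below r y' - u') + (below r (1 - y') - w') \<le> (below r y - u) + (below r (1 - y) - w) - r\<^sup>2 / 20000"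
  proof (cases "\<bar>x' - x\<bar> \<ge> r / 2 \<or> \<beta> \<le> r / 2")
    case True
    have "u' = below r y' \<or> below r y' - u' \<le> (below r y - u) - r\<^sup>2 / 20000"
      "w' = below r (1 - y') \<or> below r (1 - y') - w' \<le> (below r (1 - y) - w) - r\<^sup>2 / 20000"
      "below r y' - u' \<le> below r y - u" "below r (1 - y') - w' \<le> below r (1 - y) - w"
      using fast[OF True] r2 u w lu lw \<beta> unfolding u' w' min_def by (simp_all, linarith+)
    then show ?thesis by linarith
  next
    case False
    note s = slow[OF False]
    have "r / 100 \<le> V" using s False sqs(4) r by linarith
    then have "below r y' - u' \<le> (below r y - u) - r / 100"
      using s lu unfolding u' min_def by (auto split: if_splits)
    moreover have "below r (1 - y') - w' \<le> (below r (1 - y) - w) + r\<^sup>2 / 12500"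
      using s lw w r2 unfolding w' min_def by (auto split: if_splits)
    ultimately show ?thesis using sqs(4) r by linarith
  qed
  assume l: "u = below r y" "w = below r (1 - y)"
  have "x' - x \<le> - r / 2"
    by (rule locked_forces_left[OF r _ ab _ _ _ \<beta>]) (use esc' l sq in auto)
  moreover from this have "\<bar>x' - x\<bar> \<ge> r / 2" using r by auto
  then have "\<beta> + r\<^sup>2 / 20000 \<le> V" using fast by simp
  moreover from this have "below r y' \<le> u + V" "below r (1 - y') \<le> w + V"
    using l lu lw r2 \<beta> by linarith+
  ultimately show "x' \<le> x - r / 2 \<and> u' = below r y' \<and> w' = below r (1 - y')"
    unfolding u' w' by auto
qed

section \<open>The three phases of the ideal pursuit\<close>

text \<open>In the first alternative the pursuers slide along the bottom and top walls. As
  \<open>below\<close> is nonnegative, \<open>u = w = 0\<close> fits the second alternative on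
  arrival at the shadow.\<close>

definition chase_inv :: "real \<Rightarrow> real \<Rightarrow> real \<Rightarrow> real \<Rightarrow> real \<Rightarrow> real \<Rightarrow> bool" where
  "chase_inv r c u w x y \<longleftrightarrow> 0 \<le> c \<and> c \<le> 1 \<and> 0 \<le> u \<and> u \<le> 1 \<and> 0 \<le> w \<and> w \<le> 1 \<and>
     (shadow r x < c \<and> u = 0 \<and> w = 0 \<or>
      c = shadow r x \<and> u \<le> below r y \<and> w \<le> below r (1 - y))"

text \<open>The three cases are the phases of the pursuit: reaching the shadow of the robber from the right,
  closing the vertical gaps, driving the squeezed robber to the left. The offsets 5 and 2 make the
  potential drop at each change of phase.\<close>

definition chase_pot :: "real \<Rightarrow> real \<Rightarrow> real \<Rightarrow> real \<Rightarrow> real \<Rightarrow> real \<Rightarrow> real" where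
  "chase_pot r c u w x y =
     (if shadow r x < c then 5 + (c - shadow r x)
      else if u = below r y \<and> w = below r (1 - y) then x
      else 2 + (below r y - u) + (below r (1 - y) - w))"

lemma below_bounds: "0 \<le> below r y" "0 < r \<Longrightarrow> 0 \<le> y \<Longrightarrow> below r y \<le> y"
  by (auto simp: below_def)

lemma chase_step:
  assumes r: "0 < r" "r \<le> 3/2" and I: "chase_inv r c u w x y"
    and sq: "0 \<le> x" "x \<le> 1" "0 \<le> y" "y \<le> 1" "0 \<le> x'" "x' \<le> 1" "0 \<le> y'" "y' \<le> 1"
    and mv: "(x' - x)\<^sup>2 + (y' - y)\<^sup>2 \<le> r\<^sup>2"
    and esc1: "(r - r\<^sup>2 / 50000)\<^sup>2 < (c - x')\<^sup>2 + (u - y')\<^sup>2"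
    and esc2: "(r - r\<^sup>2 / 50000)\<^sup>2 < (c - x')\<^sup>2 + (1 - w - y')\<^sup>2"
  shows "\<exists>c' u' w'. chase_inv r c' u' w' x' y' \<and> chase_pot r c' u' w' x' y' \<le> chase_pot r c u w x y - r\<^sup>2 / 20000 \<and>
     (c' - c)\<^sup>2 + (u' - u)\<^sup>2 \<le> (r - r\<^sup>2 / 50000)\<^sup>2 \<and> (c' - c)\<^sup>2 + (w' - w)\<^sup>2 \<le> (r - r\<^sup>2 / 50000)\<^sup>2"
proof -
  define \<rho> where "\<rho> = r - r\<^sup>2 / 50000"
  note sqs = speed_sq_ge[OF r]
  have r2: "0 < r\<^sup>2" "r\<^sup>2 / 20000 \<le> 1" using r sqs(4) by auto
  have \<rho>: "0 \<le> \<rho>" using sqs(4) r by (simp add: \<rho>_def)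
  have ax: "\<bar>x' - x\<bar> \<le> r"
    using mv r by (metis abs_le_square_iff abs_of_pos le_add_same_cancel1 order_trans zero_le_power2)
  have D: "\<bar>shadow r x' - shadow r x\<bar> \<le> r - r\<^sup>2 / 1000"
  proof -
    have "\<bar>shadow r x' - shadow r x\<bar> \<le> (1 - r / 1000) * \<bar>x' - x\<bar>" by (rule shadow_diff[OF r])
    also have "\<dots> \<le> (1 - r / 1000) * r" using ax r by (intro mult_left_mono) auto
    finally show ?thesis by (simp add: algebra_simps power2_eq_square)
  qed
  have S: "0 \<le> shadow r x" "shadow r x \<le> 1" "0 \<le> shadow r x'" "shadow r x' \<le> 1"
    using shadow_bounds[OF r] sq by force+
  have B: "0 \<le> below r y'" "below r y' \<le> y'" "0 \<le> below r (1 - y')" "below r (1 - y') \<le> 1 - y'"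
    using below_bounds r sq by auto
  show ?thesis
  proof (cases "shadow r x < c")
    case True
    then have z: "u = 0" "w = 0" using I by (auto simp: chase_inv_def)
    define c' where "c' = max (shadow r x') (c - \<rho>)"
    have "shadow r x' \<le> c + \<rho>" using D True r2 unfolding \<rho>_def by linarith
    then have "c - \<rho> \<le> c'" "c' \<le> c + \<rho>" using \<rho> by (auto simp: c'_def)
    then have "\<bar>c' - c\<bar> \<le> \<rho>" by linarith
    then have "\<bar>c' - c\<bar>\<^sup>2 \<le> \<rho>\<^sup>2" by (intro power_mono) auto
    moreover have "chase_inv r c' 0 0 x' y'"
      using S B I \<rho> by (auto simp: chase_inv_def c'_def max_def split: if_splits)
    moreover have "chase_pot r c' 0 0 x' y' \<le> chase_pot r c u w x y - r\<^sup>2 / 20000"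

    proof (cases "shadow r x' < c - \<rho>")
      case t: True
      then have "c' = c - \<rho>" by (simp add: c'_def)
      \<comment> \<open>The shadow covers at most \<open>r - r^2 / 1000\<close> per round, which is
        slower than \<open>\<rho> = r - r^2 / 50000\<close> by more than the required drop.\<close>
      moreover have "shadow r x - shadow r x' \<le> \<rho> - r\<^sup>2 / 20000"
        using D r2 unfolding \<rho>_def by linarith
      ultimately show ?thesis using True t by (simp add: chase_pot_def)
    next
      case False
      then have "c' = shadow r x'" by (simp add: c'_def)
      then have "chase_pot r c' 0 0 x' y' \<le> 4" using B sq by (simp add: chase_pot_def)
      moreover have "5 \<le> chase_pot r c u w x y" using True by (simp add: chase_pot_def)
      ultimately show ?thesis using r2 by linarith
    qed
    ultimately show ?thesis unfolding z \<rho>_def by (intro exI[of _ c'] exI[of _ 0]) auto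
  next
    case False
    then have c: "c = shadow r x" and uw: "u \<le> below r y" "w \<le> below r (1 - y)"
      "0 \<le> u" "0 \<le> w"
      using I by (auto simp: chase_inv_def)
    \<comment> \<open>The part of the speed \<open>\<rho>\<close> that remains for vertical motion
      once the pursuers have followed the shadow horizontally.\<close>
    define V where "V = sqrt (\<rho>\<^sup>2 - (shadow r x' - shadow r x)\<^sup>2)"
    have "\<bar>shadow r x' - shadow r x\<bar> \<le> \<rho>" using D r2 unfolding \<rho>_def by linarith
    then have "\<bar>shadow r x' - shadow r x\<bar> \<le> \<bar>\<rho>\<bar>" by linarith
    then have V2: "V\<^sup>2 = \<rho>\<^sup>2 - (shadow r x' - shadow r x)\<^sup>2"
      unfolding V_def by (simp add: abs_le_square_iff)
    have V0: "V \<ge> 0" unfolding V_def using V2 by (metis V_def real_sqrt_ge_zero zero_le_power2)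
    define u' where "u' = min (below r y') (u + V)"
    define w' where "w' = min (below r (1 - y')) (w + V)"
    have "u - V \<le> below r y' \<and> w - V \<le> below r (1 - y') \<and>
      (u' = below r y' \<and> w' = below r (1 - y') \<or>
       (below r y' - u') + (below r (1 - y') - w') \<le> (below r y - u) + (below r (1 - y) - w) - r\<^sup>2 / 20000) \<and>
      (u = below r y \<longrightarrow> w = below r (1 - y) \<longrightarrow>
         x' \<le> x - r / 2 \<and> u' = below r y' \<and> w' = below r (1 - y'))"
    proof (cases "y' \<le> y")
      case True
      show ?thesis
        using squeeze_step[OF r sq(1,2,5,6,7) True mv uw(1,2) esc1[unfolded c] V0 V2[unfolded \<rho>_def] u'_def w'_def]
        by blast
    next
      case False
      \<comment> \<open>Reflection in the horizontal midline turns an upward move into a downward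
        one and exchanges \<open>u\<close> and \<open>w\<close>.\<close>
      have m: "0 \<le> 1 - y'" "1 - y' \<le> 1 - y" "(x' - x)\<^sup>2 + ((1 - y') - (1 - y))\<^sup>2 \<le> r\<^sup>2"
        "u \<le> below r (1 - (1 - y))"
        "(r - r\<^sup>2 / 50000)\<^sup>2 < (shadow r x - x')\<^sup>2 + (w - (1 - y'))\<^sup>2"
        "u' = min (below r (1 - (1 - y'))) (u + V)"
        using False sq mv uw esc2 u'_def by (auto simp: power2_commute c algebra_simps)
      show ?thesis
        using squeeze_step[OF r sq(1,2,5,6) m(1,2,3) uw(2) m(4,5) V0 V2[unfolded \<rho>_def] w'_def m(6)]
        by (auto simp: algebra_simps)
    qed
    then have *: "u - V \<le> below r y'" "w - V \<le> below r (1 - y')"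
      "u' = below r y' \<and> w' = below r (1 - y') \<or>
       (below r y' - u') + (below r (1 - y') - w') \<le> (below r y - u) + (below r (1 - y) - w) - r\<^sup>2 / 20000"
      "u = below r y \<Longrightarrow> w = below r (1 - y) \<Longrightarrow>
         x' \<le> x - r / 2 \<and> u' = below r y' \<and> w' = below r (1 - y')"
      by blast+
    have b: "0 \<le> u'" "0 \<le> w'" "u' \<le> below r y'" "w' \<le> below r (1 - y')"
      "\<bar>u' - u\<bar> \<le> V" "\<bar>w' - w\<bar> \<le> V"
      using B uw V0 *(1,2) by (auto simp: u'_def w'_def)
    have "\<bar>u' - u\<bar>\<^sup>2 \<le> V\<^sup>2" "\<bar>w' - w\<bar>\<^sup>2 \<le> V\<^sup>2" using b(5,6) by (intro power_mono; simp)+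
    then have d: "(shadow r x' - c)\<^sup>2 + (u' - u)\<^sup>2 \<le> \<rho>\<^sup>2" "(shadow r x' - c)\<^sup>2 + (w' - w)\<^sup>2 \<le> \<rho>\<^sup>2"
      using V2 by (auto simp: c)
    have "chase_inv r (shadow r x') u' w' x' y'"
      using b B S sq by (auto simp: chase_inv_def)
    moreover have "chase_pot r (shadow r x') u' w' x' y' \<le> chase_pot r c u w x y - r\<^sup>2 / 20000"
    proof (cases "u = below r y \<and> w = below r (1 - y)")
      case True
      then show ?thesis using *(4) sqs(4) r by (auto simp: chase_pot_def c)
    next
      case F: False
      \<comment> \<open>Either the sum of the gaps drops, or both gaps close and the potential falls
        from at least 2 to \<open>x'\<close>, which is at most 1.\<close>
      then show ?thesis using *(3) uw b r2 sq by (auto simp: chase_pot_def c)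
    qed
    ultimately show ?thesis using d unfolding \<rho>_def by blast
  qed
qed


section \<open>The game on a dense point set\<close>

lemma dist_pair_le_iff:
  fixes a b c d :: real
  assumes "0 \<le> s"
  shows "dist (a, b) (c, d) \<le> s \<longleftrightarrow> (a - c)\<^sup>2 + (b - d)\<^sup>2 \<le> s\<^sup>2"
  using assms by (simp add: dist_Pair_Pair dist_real_def real_sqrt_le_iff' sqrt_le_D real_le_lsqrt)

text \<open>Each cop stays within \<open>r^2 / 100000\<close> of an ideal pursuer. The two end
  errors of a move fit into the speed reduction \<open>r^2 / 50000\<close>, so real moves have
  length at most \<open>r\<close>; a robber out of a cop's reach is also out of reach of the slower
  pursuer.\<close>

lemma cops_win_dense:
  assumes r: "0 < r" "r \<le> 3/2"
    and pts: "\<And>i. i < n \<Longrightarrow> X i \<in> unit_square"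
    and dense: "\<And>p. p \<in> unit_square \<Longrightarrow> \<exists>i<n. dist (X i) p \<le> r\<^sup>2 / 100000"
  shows "cops_win {..<n} (geom_adj X r) 2"
proof -
  let ?N = "closed_nbhd {..<n} (geom_adj X r)"
  define P :: "real \<Rightarrow> real \<Rightarrow> real \<Rightarrow> nat \<Rightarrow> real \<times> real"
    where "P c u w i = (if i = 0 then (c, u) else (c, 1 - w))" for c u w i
  define ok where "ok k c u w \<longleftrightarrow> (\<forall>i<2. k i < n \<and> dist (X (k i)) (P c u w i) \<le> r\<^sup>2 / 100000)"
    for k :: "nat \<Rightarrow> nat" and c u w
  \<comment> \<open>The first disjunct precedes the robber's placement, with the pursuers in the two
    right-hand corners. After the placement the potential is at most 6, so 7 pays for the first
    round, in which the cops do not move.\<close>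
  define W where "W k L \<phi> \<longleftrightarrow> (L = {..<n} \<and> \<phi> = 7 \<and> ok k 1 0 0) \<or>
     (\<exists>v c u w. v < n \<and> L = ?N v \<and> ok k c u w \<and> chase_inv r c u w (fst (X v)) (snd (X v)) \<and>
        \<phi> = chase_pot r c u w (fst (X v)) (snd (X v)))" for k L \<phi>
  note sqs = speed_sq_ge[OF r]
  have \<rho>: "0 \<le> r - r\<^sup>2 / 50000" using sqs(4) r by linarith
  have N: "u \<in> ?N v \<longleftrightarrow> dist (X v) (X u) \<le> r" if "u < n" "v < n" for u v
    using that r by (auto simp: closed_nbhd_def geom_adj_def)
  have crd: "0 \<le> fst (X v)" "fst (X v) \<le> 1" "0 \<le> snd (X v)" "snd (X v) \<le> 1" if "v < n" for v
    using pts[OF that] by (auto simp: unit_square_def mem_Times_iff)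
  have NV: "v < n" if "v \<in> ?N u" "u < n" for u v
    using that by (auto simp: closed_nbhd_def)
  have place: "\<exists>k. ok k c u w" if "0 \<le> c" "c \<le> 1" "0 \<le> u" "u \<le> 1" "0 \<le> w" "w \<le> 1" for c u w
  proof -
    have "P c u w i \<in> unit_square" for i using that by (auto simp: P_def unit_square_def)
    then have "\<forall>i. \<exists>j<n. dist (X j) (P c u w i) \<le> r\<^sup>2 / 100000" using dense by blast
    then show ?thesis unfolding ok_def by metis
  qed
  obtain k0 where k0: "ok k0 1 0 0" using place[of 1 0 0] by auto
  show ?thesis
  proof (rule cops_win_by_potential[where W = W and start = k0 and bnd = 7 and d = "r\<^sup>2 / 20000"])
    show "r\<^sup>2 / 20000 > 0" using r by simp
    show "W k0 {..<n} 7" using k0 by (simp add: W_def)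
    show "\<phi> \<ge> 0" if "W k L \<phi>" for k L \<phi>
      using that crd unfolding W_def chase_inv_def chase_pot_def by auto
    show "k0 i \<in> {..<n}" if "i < 2" for i using that k0 by (auto simp: ok_def)
    fix k L \<phi> v
    assume W: "W k L \<phi>" and v: "v \<in> L" and free: "\<forall>i<2. v \<notin> ?N (k i)"
    from W consider "L = {..<n}" "\<phi> = 7" "ok k 1 0 0"
      | q c u w where "q < n" "L = ?N q" "ok k c u w" "chase_inv r c u w (fst (X q)) (snd (X q))"
          "\<phi> = chase_pot r c u w (fst (X q)) (snd (X q))"
      unfolding W_def by blast
    then show "\<exists>k' \<phi>'. W k' (?N v) \<phi>' \<and> \<phi>' \<le> \<phi> - r\<^sup>2 / 20000 \<and> (\<forall>i<2. k' i \<in> ?N (k i))"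
    proof cases
      case 1
      then have vn: "v < n" using v by simp
      note c = crd[OF vn]
      define \<phi>' where "\<phi>' = chase_pot r 1 0 0 (fst (X v)) (snd (X v))"
      note sb = shadow_bounds[OF r c(1,2)]
      have b: "0 \<le> below r (snd (X v))" "below r (snd (X v)) \<le> snd (X v)"
          "0 \<le> below r (1 - snd (X v))" "below r (1 - snd (X v)) \<le> 1 - snd (X v)"
        using below_bounds r c by auto
      have "chase_inv r 1 0 0 (fst (X v)) (snd (X v))"
        using sb b c by (auto simp: chase_inv_def)
      then have "W k (?N v) \<phi>'" using 1 vn unfolding W_def \<phi>'_def by blast
      moreover have "\<phi>' \<le> 6" using sb b c by (auto simp: \<phi>'_def chase_pot_def)
      then have "\<phi>' \<le> \<phi> - r\<^sup>2 / 20000" using 1 sqs(4) r by linarith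
      ultimately show ?thesis by (auto simp: closed_nbhd_def)
    next
      case 2
      have vn: "v < n" using NV v 2 by blast
      have kn: "k i < n" and kd: "dist (X (k i)) (P c u w i) \<le> r\<^sup>2 / 100000" if "i < 2" for i
        using 2(3) that by (auto simp: ok_def)
      have esc: "r - r\<^sup>2 / 50000 < dist (P c u w i) (X v)" if "i < 2" for i
      proof -
        have "r < dist (X (k i)) (X v)" using free that N[OF vn kn[OF that]] by auto
        then show ?thesis
          using kd[OF that] dist_triangle[of "X (k i)" "X v" "P c u w i"]
            zero_le_power2[of r] by linarith
      qed
      have esc1: "(r - r\<^sup>2 / 50000)\<^sup>2 < (c - fst (X v))\<^sup>2 + (u - snd (X v))\<^sup>2"
        using esc[of 0] dist_pair_le_iff[OF \<rho>, of c u "fst (X v)" "snd (X v)"] by (simp add: P_def)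
      have esc2: "(r - r\<^sup>2 / 50000)\<^sup>2 < (c - fst (X v))\<^sup>2 + (1 - w - snd (X v))\<^sup>2"
        using esc[of 1] dist_pair_le_iff[OF \<rho>, of c "1 - w" "fst (X v)" "snd (X v)"] by (simp add: P_def)
      have "dist (X v) (X q) \<le> r" using v 2 N[OF vn 2(1)] by (simp add: dist_commute)
      then have mv: "(fst (X v) - fst (X q))\<^sup>2 + (snd (X v) - snd (X q))\<^sup>2 \<le> r\<^sup>2"
        using dist_pair_le_iff[of r "fst (X v)" "snd (X v)" "fst (X q)" "snd (X q)"] r by simp
      obtain c' u' w' where *: "chase_inv r c' u' w' (fst (X v)) (snd (X v))"
        "chase_pot r c' u' w' (fst (X v)) (snd (X v)) \<le> \<phi> - r\<^sup>2 / 20000"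
        "(c' - c)\<^sup>2 + (u' - u)\<^sup>2 \<le> (r - r\<^sup>2 / 50000)\<^sup>2" "(c' - c)\<^sup>2 + (w' - w)\<^sup>2 \<le> (r - r\<^sup>2 / 50000)\<^sup>2"
        using chase_step[OF r 2(4) crd[OF 2(1)] crd[OF vn] mv esc1 esc2] 2(5) by blast
      obtain k' where k': "ok k' c' u' w'" using place[of c' u' w'] * by (auto simp: chase_inv_def)
      have "k' i \<in> ?N (k i)" if i: "i < 2" for i
      proof -
        have "(w - w')\<^sup>2 = (1 - w' - (1 - w))\<^sup>2" by simp
        then have "dist (P c' u' w' i) (P c u w i) \<le> r - r\<^sup>2 / 50000"
          unfolding P_def using *(3,4) by (auto simp: dist_pair_le_iff[OF \<rho>] power2_commute[of w w'])
        moreover have "dist (X (k' i)) (P c' u' w' i) \<le> r\<^sup>2 / 100000" "k' i < n"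
          using k' i by (auto simp: ok_def)
        moreover have "dist (X (k i)) (X (k' i)) \<le> dist (X (k i)) (P c u w i) +
            (dist (P c' u' w' i) (P c u w i) + dist (X (k' i)) (P c' u' w' i))"
          by metric
        ultimately have "dist (X (k i)) (X (k' i)) \<le> r" using kd[OF i] by linarith
        then show ?thesis using N kn[OF i] \<open>k' i < n\<close> by blast
      qed
      moreover have "W k' (?N v) (chase_pot r c' u' w' (fst (X v)) (snd (X v)))"
        using vn k' * unfolding W_def by blast
      ultimately show ?thesis using *(2) by blast
    qed
  qed
qed

text \<open>Since \<open>sqrt 2 < 3/2\<close>, a cop on vertex \<open>0\<close> reaches every
  vertex. The premise of \<open>step\<close> that the robber is out of reach is then contradictory,
  so a constant potential suffices.\<close>

lemma cops_win_large_radius: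
  assumes r: "3/2 \<le> r" and n: "0 < n"
    and pts: "\<And>i. i < n \<Longrightarrow> X i \<in> unit_square"
  shows "cops_win {..<n} (geom_adj X r) 2"
proof (rule cops_win_by_potential[where W = "\<lambda>c L \<phi>. c = (\<lambda>_. 0) \<and> L = {..<n} \<and> \<phi> = 0" and start = "\<lambda>_. 0" and bnd = 0 and d = 1])
  fix c :: "nat \<Rightarrow> nat" and L \<phi> v
  assume "c = (\<lambda>_. 0) \<and> L = {..<n} \<and> \<phi> = (0 :: real)" "v \<in> L"
    and free: "\<forall>i<2. v \<notin> closed_nbhd {..<n} (geom_adj X r) (c i)"
  then have c: "c = (\<lambda>_. 0)" "v < n" by auto
  define x y x' y' where "x = fst (X 0)" and "y = snd (X 0)" and "x' = fst (X v)" and "y' = snd (X v)"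
  have "\<bar>x - x'\<bar> \<le> 1" "\<bar>y - y'\<bar> \<le> 1"
    using pts[OF n] pts[OF c(2)] by (auto simp: unit_square_def x_def x'_def y_def y'_def mem_Times_iff)
  then have "\<bar>x - x'\<bar>\<^sup>2 \<le> 1\<^sup>2" "\<bar>y - y'\<bar>\<^sup>2 \<le> 1\<^sup>2" by (intro power_mono; simp)+
  moreover have "(3/2)\<^sup>2 \<le> r\<^sup>2" using r by (intro power_mono) auto
  ultimately have "(x - x')\<^sup>2 + (y - y')\<^sup>2 \<le> r\<^sup>2" by (simp add: power2_eq_square)
  then have "dist (X 0) (X v) \<le> r"
    using dist_pair_le_iff[of r x y x' y'] r by (simp add: x_def x'_def y_def y'_def)
  then have "v \<in> closed_nbhd {..<n} (geom_adj X r) (c 0)"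
    using c by (auto simp: closed_nbhd_def geom_adj_def)
  then show "\<exists>c' \<phi>'. (c' = (\<lambda>_. 0) \<and> closed_nbhd {..<n} (geom_adj X r) v = {..<n} \<and> \<phi>' = 0) \<and>
      \<phi>' \<le> \<phi> - 1 \<and> (\<forall>i<2. c' i \<in> closed_nbhd {..<n} (geom_adj X r) (c i))"
    using free by auto
qed (use n in auto)

section \<open>Random geometric graphs\<close>

lemma cops_win_mono_cong:
  assumes "\<And>i j. i \<in> V \<Longrightarrow> j \<in> V \<Longrightarrow> E i j = E' i j" "cops_win V E k"
  shows "cops_win V E' k"
proof -
  have N: "closed_nbhd V E v = closed_nbhd V E' v" if "v \<in> V" for v
    using that assms(1) by (auto simp: closed_nbhd_def)
  obtain \<sigma> where s: "cop_strategy V E k \<sigma>" "\<And>R. robber_walk V E R \<Longrightarrow> captured k \<sigma> R"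
    using assms(2) by (auto simp: cops_win_def)
  have "cop_strategy V E' k \<sigma>" using s(1) N by (auto simp: cop_strategy_def)
  moreover have "robber_walk V E R" if "robber_walk V E' R" for R
  proof -
    have "R t \<in> V" for t
      using that by (induction t) (auto simp: robber_walk_def closed_nbhd_def, metis)
    then show ?thesis using that N by (auto simp: robber_walk_def)
  qed
  ultimately show ?thesis using s(2) unfolding cops_win_def by blast
qed

lemma cop_number_cong:
  assumes "\<And>i j. i \<in> V \<Longrightarrow> j \<in> V \<Longrightarrow> E i j = E' i j"
  shows "cop_number V E = cop_number V E'"
proof -
  have "cops_win V E = cops_win V E'"
    using cops_win_mono_cong[of V E E'] cops_win_mono_cong[of V E' E] assms by blast
  then show ?thesis by (simp add: cop_number_def)
qed

lemma sets_rgg_space: "sets (rgg_space n) = sets (PiM {..<n} (\<lambda>_. borel))"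
  unfolding rgg_space_def by (intro sets_PiM_cong) auto

lemma space_rgg_space: "space (rgg_space n) = PiE {..<n} (\<lambda>_. UNIV)"
  unfolding rgg_space_def by (simp add: space_PiM)

lemma measurable_coord [measurable]: "i < n \<Longrightarrow> (\<lambda>x. x i) \<in> borel_measurable (rgg_space n)"
  unfolding measurable_cong_sets[OF sets_rgg_space refl] by (rule measurable_component_singleton) simp

text \<open>There are only finitely many edge sets on the vertices, and the cop number depends on
  nothing else; each edge set is prescribed by measurable conditions on distances.\<close>

lemma cop_number_event_measurable:
  "{x \<in> space (rgg_space n). cop_number {..<n} (geom_adj x \<rho>) \<le> k} \<in> sets (rgg_space n)"
proof -
  define I where "I = {..<n} \<times> {..<n}"
  define F where "F S = cop_number {..<n} (\<lambda>i j. (i, j) \<in> S)" for S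
  have fin: "finite I" by (simp add: I_def)
  have adj: "{x \<in> space (rgg_space n). \<forall>p\<in>I. geom_adj x \<rho> (fst p) (snd p) \<longleftrightarrow> p \<in> S} \<in> sets (rgg_space n)" for S
  proof (rule sets.sets_Collect_finite_All[OF _ fin])
    fix p assume "p \<in> I"
    then have [measurable]: "(\<lambda>x. x (fst p)) \<in> borel_measurable (rgg_space n)"
      "(\<lambda>x. x (snd p)) \<in> borel_measurable (rgg_space n)"
      by (auto simp: I_def)
    show "{x \<in> space (rgg_space n). geom_adj x \<rho> (fst p) (snd p) \<longleftrightarrow> p \<in> S} \<in> sets (rgg_space n)"
      unfolding geom_adj_def by measurable
  qed
  define G where "G x = {p\<in>I. geom_adj x \<rho> (fst p) (snd p)}" for x
  have FG: "cop_number {..<n} (geom_adj x \<rho>) = F (G x)" for x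
    unfolding F_def by (intro cop_number_cong) (auto simp: I_def G_def)
  have GS: "(\<forall>p\<in>I. geom_adj x \<rho> (fst p) (snd p) \<longleftrightarrow> p \<in> S) \<longleftrightarrow> G x = S" if "S \<subseteq> I" for x S
    using that by (auto simp: G_def)
  have "G x \<subseteq> I" for x by (auto simp: G_def)
  then have "{x \<in> space (rgg_space n). cop_number {..<n} (geom_adj x \<rho>) \<le> k} =
    (\<Union>S\<in>{S\<in>Pow I. F S \<le> k}. {x \<in> space (rgg_space n). G x = S})"
    unfolding FG by auto
  also have "\<dots> = (\<Union>S\<in>{S\<in>Pow I. F S \<le> k}.
      {x \<in> space (rgg_space n). \<forall>p\<in>I. geom_adj x \<rho> (fst p) (snd p) \<longleftrightarrow> p \<in> S})"
    by (intro SUP_cong) (auto simp: GS)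
  also have "\<dots> \<in> sets (rgg_space n)"
    using fin adj by (intro sets.finite_UN) auto
  finally show ?thesis .
qed

section \<open>The uniform measure on the square and its product\<close>

lemma unit_square_cbox: "unit_square = cbox (0, 0) (1, 1)"
  by (simp add: unit_square_def cbox_Pair_eq)

lemma emeasure_cbox2:
  assumes "a \<le> b" "c \<le> d"
  shows "emeasure lborel (cbox (a, c) (b, d) :: (real \<times> real) set) = ennreal ((b - a) * (d - c))"
proof -
  have "emeasure lborel (cbox (a, c) (b, d) :: (real \<times> real) set) =
      emeasure (lborel \<Otimes>\<^sub>M lborel) (cbox a b \<times> cbox c d)"
    by (simp add: lborel_prod cbox_Pair_eq)
  also have "\<dots> = emeasure lborel (cbox a b) * emeasure lborel (cbox c d)"
    by (rule lborel.emeasure_pair_measure_Times) auto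
  finally show ?thesis using assms by (simp add: ennreal_mult)
qed

abbreviation "usq \<equiv> uniform_measure lborel unit_square"

lemma emeasure_unit_square: "emeasure lborel unit_square = 1"
  by (simp add: unit_square_cbox emeasure_cbox2)

lemma prob_space_usq: "prob_space usq"
  by (rule prob_space_uniform_measure) (auto simp: emeasure_unit_square)

lemma unit_square_borel [measurable]: "unit_square \<in> sets borel"
  by (simp add: unit_square_cbox)

lemma measure_usq_cbox:
  assumes "0 \<le> a" "a \<le> b" "b \<le> 1" "0 \<le> c" "c \<le> d" "d \<le> 1"
  shows "measure usq (cbox (a, c) (b, d)) = (b - a) * (d - c)"
proof -
  have "unit_square \<inter> cbox (a, c) (b, d) = cbox (a, c) (b, d)"
    using assms by (auto simp: unit_square_def cbox_Pair_eq)
  then have "emeasure usq (cbox (a, c) (b, d)) = ennreal ((b - a) * (d - c))"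
    using assms by (simp add: emeasure_uniform_measure emeasure_unit_square emeasure_cbox2 divide_ennreal_def)
  then show ?thesis using assms by (simp add: measure_def)
qed

lemma product_prob_space_usq: "product_prob_space (\<lambda>_. usq)"
  using prob_space_usq
  by (auto simp: product_prob_space_def product_prob_space_axioms_def product_sigma_finite_def
     intro!: prob_space_imp_sigma_finite)

lemma prob_space_rgg: "prob_space (rgg_space n)"
  unfolding rgg_space_def by (intro prob_space_PiM prob_space_usq)

lemma prob_avoid:
  assumes [measurable]: "A \<in> sets borel"
  shows "measure (rgg_space n) {x \<in> space (rgg_space n). \<forall>i<n. x i \<notin> A} = (1 - measure usq A) ^ n"
proof -
  interpret product_prob_space "\<lambda>_. usq" "{..<n}" by (rule product_prob_space_usq)
  have eq: "{x \<in> space (rgg_space n). \<forall>i<n. x i \<notin> A} = PiE {..<n} (\<lambda>_. space usq - A)"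
    by (auto simp: space_rgg_space PiE_def extensional_def)
  have "emeasure (rgg_space n) {x \<in> space (rgg_space n). \<forall>i<n. x i \<notin> A} = (\<Prod>i\<in>{..<n}. emeasure usq (space usq - A))"
    unfolding eq unfolding rgg_space_def by (rule emeasure_PiM) auto
  also have "\<dots> = ennreal ((1 - measure usq A) ^ n)"
  proof -
    have "measure usq (space usq - A) = 1 - measure usq A" 
      by (rule prob_space.prob_compl[OF prob_space_usq]) simp
    then have "emeasure usq (space usq - A) = ennreal (1 - measure usq A)"
      
      by (simp add: finite_measure.emeasure_eq_measure[OF prob_space.finite_measure[OF prob_space_usq]])
    then show ?thesis by (simp add: ennreal_power)
  qed
  finally show ?thesis
    using prob_space.prob_le_1[OF prob_space_usq, of A] by (simp add: measure_eq_emeasure_eq_ennreal)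
qed

text \<open>The space of \<open>usq\<close> is the whole plane, so points lie in the square only
  almost surely; the exceptional events enter the union bound with weight zero.\<close>

lemma prob_outside:
  assumes "i < n"
  shows "measure (rgg_space n) {x \<in> space (rgg_space n). x i \<notin> unit_square} = 0"
proof -
  interpret product_prob_space "\<lambda>_. usq" "{..<n}" by (rule product_prob_space_usq)
  have "emeasure (rgg_space n) {x \<in> space (rgg_space n). x i \<in> - unit_square} = emeasure usq (- unit_square)"
    unfolding rgg_space_def using assms by (intro emeasure_PiM_Collect_single) auto
  also have "\<dots> = 0" by (simp add: emeasure_uniform_measure)
  finally show ?thesis by (simp add: measure_def)
qed

section \<open>Covering the square by grid cells\<close>

definition grid_cell :: "nat \<Rightarrow> nat \<times> nat \<Rightarrow> (real \<times> real) set" where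
  "grid_cell m = (\<lambda>(i, j). cbox (real i / real m, real j / real m) (real (Suc i) / real m, real (Suc j) / real m))"

lemma grid_cell_index:
  fixes t :: real
  assumes "0 \<le> t" "t \<le> 1" "0 < m"
  shows "\<exists>i<m. real i / real m \<le> t \<and> t \<le> real (Suc i) / real m"
\<comment> \<open>At \<open>t = 1\<close> the floor would give the index \<open>m\<close>, one too
  large; the last closed cell contains this point.\<close>
proof (cases "t = 1")
  case True
  then show ?thesis using assms by (intro exI[of _ "m - 1"]) (auto simp: field_simps)
next
  case False
  define i where "i = nat \<lfloor>t * m\<rfloor>"
  have "real i \<le> t * m" "t * m < real i + 1" using assms by (auto simp: i_def of_nat_nat)
  moreover have "t * real m < 1 * real m" using False assms by (intro mult_strict_right_mono) auto
  ultimately have "i < m" by linarith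
  moreover have "real i / real m \<le> t" "t \<le> real (Suc i) / real m"
    using \<open>real i \<le> t * m\<close> \<open>t * m < real i + 1\<close> assms by (auto simp: field_simps)
  ultimately show ?thesis by blast
qed

lemma unit_square_grid:
  assumes "p \<in> unit_square" "0 < m"
  shows "\<exists>c \<in> {..<m} \<times> {..<m}. p \<in> grid_cell m c"
proof -
  obtain x y where p: "p = (x, y)" by (cases p)
  have "0 \<le> x" "x \<le> 1" "0 \<le> y" "y \<le> 1" using assms by (auto simp: unit_square_def p)
  then obtain i j where "i < m" "real i / real m \<le> x \<and> x \<le> real (Suc i) / real m"
    "j < m" "real j / real m \<le> y \<and> y \<le> real (Suc j) / real m"
    using grid_cell_index assms(2) by meson
  then show ?thesis by (intro bexI[of _ "(i, j)"]) (auto simp: grid_cell_def p)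
qed

lemma grid_cell_diam:
  assumes "p \<in> grid_cell m c" "q \<in> grid_cell m c"
  shows "dist p q \<le> 2 / real m"
proof -
  obtain i j where c: "c = (i, j)" by (cases c)
  obtain x y x' y' where pq: "p = (x, y)" "q = (x', y')" by (cases p; cases q)
  have "dist p q \<le> \<bar>x - x'\<bar> + \<bar>y - y'\<bar>"
    unfolding pq dist_Pair_Pair dist_real_def using sqrt_sum_squares_le_sum_abs by simp
  moreover have "\<bar>x - x'\<bar> \<le> 1 / real m" "\<bar>y - y'\<bar> \<le> 1 / real m"
    using assms by (auto simp: grid_cell_def pq c add_divide_distrib)
  ultimately show ?thesis by simp
qed

lemma measure_grid_cell:
  assumes "c \<in> {..<m} \<times> {..<m}"
  shows "measure usq (grid_cell m c) = 1 / (real m)\<^sup>2"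
proof -
  obtain i j where c: "c = (i, j)" "i < m" "j < m" using assms by (cases c) auto
  have "measure usq (grid_cell m c) = (real (Suc i) / real m - real i / real m) * (real (Suc j) / real m - real j / real m)"
    unfolding c grid_cell_def prod.case using c by (intro measure_usq_cbox) (auto simp: field_simps)
  also have "\<dots> = 1 / (real m)\<^sup>2" using c by (simp add: diff_divide_distrib[symmetric] power2_eq_square)
  finally show ?thesis .
qed

section \<open>The probability estimate\<close>

lemma cop_number_le_2_if_hit:
  assumes m: "0 < m" "2 / real m \<le> (min \<rho> (3/2))\<^sup>2 / 100000" and \<rho>: "0 < \<rho>"
    and pts: "\<And>i. i < n \<Longrightarrow> x i \<in> unit_square"
    and hit: "\<And>c. c \<in> {..<m} \<times> {..<m} \<Longrightarrow> \<exists>i<n. x i \<in> grid_cell m c"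
  shows "cop_number {..<n} (geom_adj x \<rho>) \<le> 2"
proof -
  have dense: "\<exists>i<n. dist (x i) p \<le> (min \<rho> (3/2))\<^sup>2 / 100000" if "p \<in> unit_square" for p
    using unit_square_grid[OF that m(1)] hit grid_cell_diam m(2) by (meson order_trans)
  have "cops_win {..<n} (geom_adj x \<rho>) 2"
  proof (cases "\<rho> \<le> 3/2")
    case True
    then show ?thesis using cops_win_dense[OF \<rho> True pts] dense by (simp add: min_absorb1)
  next
    case False
    have "0 < n" using hit[of "(0, 0)"] m by auto
    then show ?thesis using False pts by (intro cops_win_large_radius) auto
  qed
  then show ?thesis unfolding cop_number_def by (rule Least_le)
qed

text \<open>Union bound: the cop number can exceed 2 only if one of the \<open>m^2\<close> cells is
  empty or some point misses the square.\<close>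

lemma prob_cop_number_le_2:
  assumes m: "0 < m" "2 / real m \<le> (min \<rho> (3/2))\<^sup>2 / 100000" and \<rho>: "0 < \<rho>"
  shows "1 - (real m)\<^sup>2 * (1 - 1 / (real m)\<^sup>2) ^ n \<le>
    measure (rgg_space n) {x \<in> space (rgg_space n). cop_number {..<n} (geom_adj x \<rho>) \<le> 2}"
proof -
  interpret prob_space "rgg_space n" by (rule prob_space_rgg)
  let ?M = "rgg_space n" and ?C = "{..<m} \<times> {..<m}"
  let ?A = "{x \<in> space ?M. cop_number {..<n} (geom_adj x \<rho>) \<le> 2}"
  let ?B = "\<lambda>c. {x \<in> space ?M. \<forall>i<n. x i \<notin> grid_cell m c}"
  let ?O = "\<lambda>i. {x \<in> space ?M. x i \<notin> unit_square}"
  have [measurable]: "grid_cell m c \<in> sets borel" for c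
    by (cases c) (simp add: grid_cell_def)
  have B: "?B c \<in> events" for c by measurable
  have O: "?O i \<in> events" if "i < n" for i using that by measurable
  have A: "?A \<in> events" by (rule cop_number_event_measurable)
  have "space ?M - ?A \<subseteq> (\<Union>c\<in>?C. ?B c) \<union> (\<Union>i\<in>{..<n}. ?O i)"
  proof
    fix x assume "x \<in> space ?M - ?A"
    then show "x \<in> (\<Union>c\<in>?C. ?B c) \<union> (\<Union>i\<in>{..<n}. ?O i)"
      using cop_number_le_2_if_hit[OF m \<rho>, of n x] by blast
  qed
  then have "prob (space ?M - ?A) \<le> prob ((\<Union>c\<in>?C. ?B c) \<union> (\<Union>i\<in>{..<n}. ?O i))"
    using B O by (intro finite_measure_mono sets.Un sets.finite_UN) auto
  also have "\<dots> \<le> prob (\<Union>c\<in>?C. ?B c) + prob (\<Union>i\<in>{..<n}. ?O i)"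
    using B O by (intro measure_Un_le sets.finite_UN) auto
  also have "\<dots> \<le> (\<Sum>c\<in>?C. prob (?B c)) + (\<Sum>i\<in>{..<n}. prob (?O i))"
    using B O by (intro add_mono finite_measure_subadditive_finite) auto
  also have "(\<Sum>c\<in>?C. prob (?B c)) = (\<Sum>c\<in>?C. (1 - 1 / (real m)\<^sup>2) ^ n)"
    by (intro sum.cong refl) (simp add: prob_avoid measure_grid_cell)
  also have "(\<Sum>i\<in>{..<n}. prob (?O i)) = 0" by (simp add: prob_outside)
  finally show ?thesis using prob_compl[OF A] by (simp add: power2_eq_square)
qed

lemma eventually_prob_cop_number_le_2:
  fixes r :: "nat \<Rightarrow> real"
  assumes r: "\<And>n. r n \<ge> 1000 * (ln (real n) / real n) powr (1/4)"
  shows "\<forall>\<^sub>F n in sequentially. 1 - 1 / real n \<le>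
     measure (rgg_space n) {x \<in> space (rgg_space n). cop_number {..<n} (geom_adj x (r n)) \<le> 2}"
proof -
  \<comment> \<open>The scale at which \<open>exp (- n / z^2)\<close> equals \<open>1 / n^2\<close>;
    rounding down to \<open>m\<close> only improves this bound.\<close>
  define z where "z n = sqrt (real n / (2 * ln (real n)))" for n :: nat
  have "filterlim z at_top sequentially" unfolding z_def by real_asymp
  then have "\<forall>\<^sub>F n in sequentially. z n \<ge> 1000000" by (simp add: filterlim_at_top)
  then show ?thesis
    using eventually_ge_at_top[of 3]
  proof eventually_elim
    case (elim n)
    define m where "m = nat \<lfloor>z n\<rfloor>"
    have ln: "1 \<le> ln (real n)"
    proof -
      have "exp 1 \<le> real n" using exp_le elim by linarith
      then show ?thesis using ln_ge_iff[of "real n" 1] elim by simp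
    qed
    have mz: "real m \<le> z n" "z n / 2 \<le> real m" "0 < m" using elim by (auto simp: m_def of_nat_nat) linarith
    have z2: "(z n)\<^sup>2 = real n / (2 * ln (real n))" using ln by (simp add: z_def)
    have pos: "0 < ln (real n) / real n" using ln elim by simp
    have rpos: "0 < r n" using r[of n] pos by (smt (verit) powr_gt_zero mult_pos_pos)
    have two: "2 / real m \<le> 4 / z n" using mz elim by (simp add: field_simps)
    have inv: "1 / z n = sqrt 2 * sqrt (ln (real n) / real n)"
      by (simp add: z_def real_sqrt_divide real_sqrt_mult)
    have "(1000 * (ln (real n) / real n) powr (1/4))\<^sup>2 \<le> (r n)\<^sup>2"
      using r[of n] by (intro power_mono) auto
    also have "(1000 * (ln (real n) / real n) powr (1/4))\<^sup>2 = 1000000 * sqrt (ln (real n) / real n)"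
      using pos by (simp add: power_mult_distrib powr_half_sqrt[symmetric] power2_eq_square powr_add[symmetric])
    finally have r2: "1000000 * sqrt (ln (real n) / real n) \<le> (r n)\<^sup>2" .
    have "4 / z n \<le> (min (r n) (3/2))\<^sup>2 / 100000"
    proof (cases "r n \<le> 3/2")
      case True
      have "sqrt 2 \<le> 3/2" by (rule real_le_lsqrt) (auto simp: power2_eq_square)
      then have "sqrt 2 * sqrt (ln (real n) / real n) \<le> 3/2 * sqrt (ln (real n) / real n)"
        using pos by (intro mult_right_mono) auto
      moreover have "0 \<le> sqrt (ln (real n) / real n)" using pos by simp
      \<comment> \<open>Here the constant 1000 is spent: its square over 100000 is 10, while
        \<open>4 * sqrt 2\<close> is at most 6.\<close>
      ultimately have "4 * (1 / z n) \<le> (r n)\<^sup>2 / 100000" using r2 unfolding inv by linarith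
      then show ?thesis using True by simp
    next
      case False
      \<comment> \<open>For the capped radius the bound to beat is \<open>(3/2)^2 / 100000\<close>,
        which exceeds \<open>4 / 1000000\<close>.\<close>
      have "4 / z n \<le> 4 / 1000000" using elim by (intro divide_left_mono) auto
      then show ?thesis using False by (simp add: min_absorb2 power2_eq_square)
    qed
    then have *: "2 / real m \<le> (min (r n) (3/2))\<^sup>2 / 100000" using two by linarith
    have m1: "1 \<le> (real m)\<^sup>2" using mz by simp
    have m3: "1 / (real m)\<^sup>2 \<le> 1" using m1 by (subst divide_le_eq_1_pos) linarith+
    have m2: "(real m)\<^sup>2 \<le> real n / (2 * ln (real n))" using mz z2 by (metis of_nat_0_le_iff power_mono)
    have "(real m)\<^sup>2 * (1 - 1 / (real m)\<^sup>2) ^ n \<le> real n * (1 / (real n)\<^sup>2)"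
    proof (intro mult_mono)
      have "real n / (2 * ln (real n)) \<le> real n / 1" using ln by (intro divide_left_mono) auto
      then show "(real m)\<^sup>2 \<le> real n" using m2 by linarith
      have "(1 - 1 / (real m)\<^sup>2) ^ n \<le> exp (- (1 / (real m)\<^sup>2)) ^ n"
        using m3 exp_ge_add_one_self[of "- (1 / (real m)\<^sup>2)"] by (intro power_mono) auto
      also have "\<dots> = exp (- (real n / (real m)\<^sup>2))" by (simp add: exp_of_nat_mult[symmetric])
      also have "\<dots> \<le> exp (- (2 * ln (real n)))"
        using mz(3) m2 ln by (simp add: field_simps)
      also have "\<dots> = 1 / (real n)\<^sup>2"
        using elim by (simp add: exp_minus exp_double inverse_eq_divide)
      finally show "(1 - 1 / (real m)\<^sup>2) ^ n \<le> 1 / (real n)\<^sup>2" .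
    qed (use m3 in auto)
    also have "\<dots> = 1 / real n" by (simp add: power2_eq_square)
    finally show ?case using prob_cop_number_le_2[OF mz(3) * rpos, of n] by linarith
  qed
qed

theorem theorem4:
  shows "\<exists>K1 > 0. \<forall>r :: nat \<Rightarrow> real.
     (\<forall>n. r n \<ge> K1 * (ln (real n) / real n) powr (1/4)) \<longrightarrow>
     (\<lambda>n. measure (rgg_space n)
        {x \<in> space (rgg_space n). cop_number {..<n} (geom_adj x (r n)) \<le> 2})
       \<longlonglongrightarrow> 1"
proof (intro exI[of _ "1000 :: real"] conjI allI impI)
  fix r :: "nat \<Rightarrow> real"
  assume r: "\<forall>n. r n \<ge> 1000 * (ln (real n) / real n) powr (1/4)"
  show "(\<lambda>n. measure (rgg_space n)
        {x \<in> space (rgg_space n). cop_number {..<n} (geom_adj x (r n)) \<le> 2}) \<longlonglongrightarrow> 1"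
  proof (rule tendsto_sandwich)
    show "\<forall>\<^sub>F n in sequentially. 1 - 1 / real n \<le> measure (rgg_space n)
        {x \<in> space (rgg_space n). cop_number {..<n} (geom_adj x (r n)) \<le> 2}"
      using eventually_prob_cop_number_le_2 r by blast
    show "(\<lambda>n. 1 - 1 / real n) \<longlonglongrightarrow> 1" by real_asymp
    show "\<forall>\<^sub>F n in sequentially. measure (rgg_space n)
        {x \<in> space (rgg_space n). cop_number {..<n} (geom_adj x (r n)) \<le> 2} \<le> 1"
      by (simp add: prob_space.prob_le_1[OF prob_space_rgg])
  qed simp
qed simp

end
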